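(* Assume that at least one of the following problems has already been solved: nontrivial move, leader election, or direction agreement. Then the location discovery problem can be solved in $n+O(\log N)$ rounds in each of the following settings: - the lazy model, for arbitrary $n$; - the basic model, for odd $n$.
   Context: Model: $n>4$ agents are at distinct, arbitrary initial positions on a circle of circumference $1$ and act in synchronised unit-time rounds. Each agent has its own notion of right (clockwise) and left; these need not be consistent across agents. At the start of a round each agent chooses a direction and moves at unit speed. Agents never pass: two moving agents that collide instantly reverse direction, and a moving agent hitting an idle one becomes idle while the idle one starts moving in the former's objective direction. There is no communication. At the end of each round an agent learns the clockwise distance, in its own orientation, from its start-of-round to its end-of-round position. The two models differ as follows: - Basic: direction in $\{\text{right},\text{left}\}$. - Lazy: direction in $\{\text{idle},\text{right},\text{left}\}$. Agents have distinct IDs in $\{1,\dots,N\}$ with $N\ge n$ known. Rotation index: if $n_C$ agents start clockwise and $n_A$ anticlockwise (objective orientation), each agent moves to the initial position of the agent $(n_C-n_A)\bmod n$ places clockwise. A nontrivial move is a round with rotation index not in $\{0,n/2\}$. Problems: - Nontrivial move problem: each agent holds a direction such that the round in which all start in these directions is a nontrivial move. - Leader election: exactly one agent is "leader". - Direction agreement: all agents agree on which direction is clockwise. - Location discovery: each agent determines the initial positions of all other agents relative to its own initial position. *)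

theory Defs
  imports Complex_Main
begin

text \<open>Combinatorial model of synchronous rounds of n agents on a circle of
circumference 1. Agents are indexed 0..n-1 in objective clockwise order of
their initial positions p 0 < p 1 < ... < p (n-1) in [0,1) (objective clockwise
= increasing coordinate). o i = True iff agent i's own notion of clockwise
agrees with the objective one. ident i is the ID of agent i.\<close>

datatype dir = Idle | Right | Left
datatype model = Basic | Lazy

definition allowed :: "model \<Rightarrow> dir \<Rightarrow> bool" where
  "allowed m d = (m = Lazy \<or> d \<noteq> Idle)"

definition obj_cw :: "bool \<Rightarrow> dir \<Rightarrow> bool" where
  "obj_cw ori d = ((d = Right \<and> ori) \<or> (d = Left \<and> \<not> ori))"

definition obj_acw :: "bool \<Rightarrow> dir \<Rightarrow> bool" where
  "obj_acw ori d = ((d = Left \<and> ori) \<or> (d = Right \<and> \<not> ori))"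

definition rot_index :: "nat \<Rightarrow> (nat \<Rightarrow> bool) \<Rightarrow> (nat \<Rightarrow> dir) \<Rightarrow> nat" where
  "rot_index n ori c =
     nat ((int (card {i. i < n \<and> obj_cw (ori i) (c i)})
           - int (card {i. i < n \<and> obj_acw (ori i) (c i)})) mod int n)"

definition own_dist :: "bool \<Rightarrow> real \<Rightarrow> real \<Rightarrow> real" where
  "own_dist ori x y = (if ori then frac (y - x) else frac (x - y))"

definition valid_config ::
  "nat \<Rightarrow> nat \<Rightarrow> (nat \<Rightarrow> real) \<Rightarrow> (nat \<Rightarrow> nat) \<Rightarrow> bool" where
  "valid_config N n p ident =
     (4 < n \<and> n \<le> N \<and> (\<forall>i<n. 0 \<le> p i \<and> p i < 1)
      \<and> (\<forall>i j. i < j \<and> j < n \<longrightarrow> p i < p j)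
      \<and> inj_on ident {..<n} \<and> (\<forall>i<n. ident i \<in> {1..N}))"

text \<open>Execution of a deterministic algorithm alg (choice as a function of N, n,
own ID, own pre-computed input, own observation history). After t rounds:
cumulative index shift s (agent i sits at initial position of agent (i+s) mod n)
and the observation histories.\<close>
fun run :: "(nat \<Rightarrow> nat \<Rightarrow> nat \<Rightarrow> 'a \<Rightarrow> real list \<Rightarrow> dir) \<Rightarrow> nat \<Rightarrow> nat \<Rightarrow>
    (nat \<Rightarrow> real) \<Rightarrow> (nat \<Rightarrow> bool) \<Rightarrow> (nat \<Rightarrow> nat) \<Rightarrow> (nat \<Rightarrow> 'a) \<Rightarrow> nat \<Rightarrow>
    nat \<times> (nat \<Rightarrow> real list)" where
  "run alg N n p ori ident inp 0 = (0, (\<lambda>i. []))"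
| "run alg N n p ori ident inp (Suc t) =
     (case run alg N n p ori ident inp t of (s, h) \<Rightarrow>
        (let c = (\<lambda>i. alg N n (ident i) (inp i) (h i));
             r = rot_index n ori c
         in ((s + r) mod n,
             (\<lambda>i. h i @ [own_dist (ori i) (p ((i + s) mod n)) (p ((i + s + r) mod n))]))))"

definition ntm_spec :: "model \<Rightarrow> nat \<Rightarrow> (nat \<Rightarrow> bool) \<Rightarrow> (nat \<Rightarrow> dir) \<Rightarrow> bool" where
  "ntm_spec m n ori d = ((\<forall>i<n. allowed m (d i)) \<and>
     rot_index n ori d \<noteq> 0 \<and> 2 * rot_index n ori d \<noteq> n)"

definition le_spec :: "model \<Rightarrow> nat \<Rightarrow> (nat \<Rightarrow> bool) \<Rightarrow> (nat \<Rightarrow> bool) \<Rightarrow> bool" where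
  "le_spec m n ori leader = (card {i. i < n \<and> leader i} = 1)"

text \<open>Direction agreement: agent i holds keep i = True iff it takes its own
clockwise as the agreed clockwise; all agents agree on one objective direction.\<close>
definition da_spec :: "model \<Rightarrow> nat \<Rightarrow> (nat \<Rightarrow> bool) \<Rightarrow> (nat \<Rightarrow> bool) \<Rightarrow> bool" where
  "da_spec m n ori keep = (\<exists>c. \<forall>i<n. (ori i = keep i) = c)"

definition LD_solvable ::
  "model \<Rightarrow> (model \<Rightarrow> nat \<Rightarrow> (nat \<Rightarrow> bool) \<Rightarrow> (nat \<Rightarrow> 'a) \<Rightarrow> bool) \<Rightarrow> bool" where
  "LD_solvable m spec =
    (\<exists>(C::real) (alg :: nat \<Rightarrow> nat \<Rightarrow> nat \<Rightarrow> 'a \<Rightarrow> real list \<Rightarrow> dir)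
       (out :: nat \<Rightarrow> nat \<Rightarrow> nat \<Rightarrow> 'a \<Rightarrow> real list \<Rightarrow> real set) (T :: nat \<Rightarrow> nat \<Rightarrow> nat).
      (\<forall>N n x y z. allowed m (alg N n x y z)) \<and>
      (\<forall>N n. 4 < n \<and> n \<le> N \<longrightarrow> real (T N n) \<le> real n + C * log 2 (real N)) \<and>
      (\<forall>N n p ori ident inp.
         valid_config N n p ident \<and> (m = Lazy \<or> odd n) \<and> spec m n ori inp \<longrightarrow>
         (\<forall>i<n. out N n (ident i) (inp i) (snd (run alg N n p ori ident inp (T N n)) i)
                = {own_dist (ori i) (p i) (p j) | j. j < n \<and> j \<noteq> i})))"

end

theory Submission
  imports Defs "HOL-Library.Log_Nat" "HOL-Number_Theory.Cong"
begin

(* The agents first repeat a fixed default move, of rotation index r, until they are back at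
   their starting points; this takes m = n / gcd r n rounds, and meanwhile every agent visits
   the positions r, 2r, ... (mod n) ahead of it. With a nontrivial move, the number of times an
   agent wraps around the circle in these m rounds tells it whether its own clockwise is the
   objective one, which solves direction agreement. Agreeing on a direction, the agents elect a
   leader by testing the bits of their IDs: in a test round the candidates whose bit is set move
   clockwise and the others stay (lazy model) or move anticlockwise (basic model). For odd n in
   the basic model, such a round has rotation index 0 iff the candidates agree on the bit, and
   the following round undoes it. Finally, a round in which only the leader moves clockwise has
   rotation index +-1 (lazy) or +-(n - 2) (basic), which is coprime to n; interleaving such rounds
   with m - 1 default moves makes every agent visit every coset of the subgroup generated by r.
   So within n + 2 log N rounds every agent has stood at every initial position, and the
   prefix sums of its observations are the distances to all other agents. *)

section \<open>Rotation index as a signed count\<close>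

definition dir_sign :: "bool \<Rightarrow> dir \<Rightarrow> int" where
  "dir_sign ori d = of_bool (obj_cw ori d) - of_bool (obj_acw ori d)"

lemma rot_index_eq_sum_mod:
  "rot_index n ori c = nat ((\<Sum>i<n. dir_sign (ori i) (c i)) mod int n)"
proof -
  have "int (card {i. i < n \<and> P i}) = (\<Sum>i<n. of_bool (P i))" for P
    by (simp add: lessThan_def Collect_conj_eq)
  then show ?thesis
    unfolding rot_index_def dir_sign_def by (simp add: sum_subtractf)
qed

lemma rot_index_cong:
  assumes "\<And>i. i < n \<Longrightarrow> c i = c' i"
  shows "rot_index n ori c = rot_index n ori c'"
  unfolding rot_index_eq_sum_mod using assms
  by (intro arg_cong[where f = "\<lambda>s. nat (s mod int n)"] sum.cong) auto

lemma int_rot_index: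
  "0 < n \<Longrightarrow> int (rot_index n ori c) = (\<Sum>i<n. dir_sign (ori i) (c i)) mod int n"
  unfolding rot_index_eq_sum_mod by simp

lemma rot_index_less: "0 < n \<Longrightarrow> rot_index n ori c < n"
  unfolding rot_index_eq_sum_mod by (simp add: nat_less_iff)

lemma rot_index_eq_0_iff:
  "0 < n \<Longrightarrow> rot_index n ori c = 0 \<longleftrightarrow> int n dvd (\<Sum>i<n. dir_sign (ori i) (c i))"
  by (metis int_rot_index dvd_eq_mod_eq_0 of_nat_0 of_nat_eq_iff)

definition reverse_dir :: "dir \<Rightarrow> dir" where
  "reverse_dir d = (case d of Idle \<Rightarrow> Idle | Right \<Rightarrow> Left | Left \<Rightarrow> Right)"

lemma dir_sign_reverse_dir: "dir_sign ori (reverse_dir d) = - dir_sign ori d"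
  by (cases d) (auto simp: dir_sign_def obj_cw_def obj_acw_def reverse_dir_def)

lemma rot_index_reverse_dir:
  assumes "0 < n"
  shows "(rot_index n ori c + rot_index n ori (\<lambda>i. reverse_dir (c i))) mod n = 0"
proof -
  define s where "s = (\<Sum>i<n. dir_sign (ori i) (c i))"
  have "int (rot_index n ori (\<lambda>i. reverse_dir (c i))) = (- s) mod int n"
    using assms by (simp add: int_rot_index dir_sign_reverse_dir sum_negf s_def)
  then have "int ((rot_index n ori c + rot_index n ori (\<lambda>i. reverse_dir (c i))) mod n)
      = (s mod int n + (- s) mod int n) mod int n"
    using assms by (simp add: of_nat_mod int_rot_index s_def)
  also have "\<dots> = 0" by (simp add: mod_add_eq)
  finally show ?thesis by simp
qed

lemma int_dvd_iff_extreme: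
  "0 < n \<Longrightarrow> k \<le> n \<Longrightarrow> int n dvd int k \<longleftrightarrow> k = 0 \<or> k = n"
  by (auto simp: dvd_imp_le)

lemma odd_int_dvd_twice_minus_iff:
  assumes "odd n" "k \<le> n"
  shows "int n dvd 2 * int k - int n \<longleftrightarrow> k = 0 \<or> k = n"
proof -
  have "int n dvd 2 * int k - int n \<longleftrightarrow> int n dvd 2 * int k"
    using dvd_add_right_iff[of "int n" "int n" "2 * int k - int n"] by simp
  also have "\<dots> \<longleftrightarrow> int n dvd int k"
    using assms(1) by (simp add: coprime_dvd_mult_right_iff)
  finally show ?thesis
    using assms int_dvd_iff_extreme[of n k] by (cases "n = 0") auto
qed

text \<open>A round in which the agents of \<open>S\<close> move in one objective direction (sign \<open>\<sigma>\<close>) while the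
others stay (lazy model) or move the opposite way (basic model).\<close>

lemma sum_dir_sign_split:
  assumes S: "S \<subseteq> {..<n}"
    and in_S: "\<And>i. i \<in> S \<Longrightarrow> dir_sign (ori i) (c i) = \<sigma>"
    and out_S: "\<And>i. i < n \<Longrightarrow> i \<notin> S \<Longrightarrow> dir_sign (ori i) (c i) = - of_bool (mdl = Basic) * \<sigma>"
  shows "(\<Sum>i<n. dir_sign (ori i) (c i)) = \<sigma> * (int (card S) - of_bool (mdl = Basic) * int (n - card S))"
proof -
  have "(\<Sum>i<n. dir_sign (ori i) (c i))
      = (\<Sum>i\<in>{..<n} - S. dir_sign (ori i) (c i)) + (\<Sum>i\<in>S. dir_sign (ori i) (c i))"
    using S by (simp add: sum.subset_diff)
  also have "\<dots> = int (n - card S) * (- of_bool (mdl = Basic) * \<sigma>) + int (card S) * \<sigma>"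
    using S in_S out_S finite_subset[OF S] by (simp add: card_Diff_subset)
  finally show ?thesis by (simp add: algebra_simps)
qed

lemma rot_index_split_eq_0_iff:
  assumes "S \<subseteq> {..<n}" "0 < n" "mdl = Lazy \<or> odd n" "\<bar>\<sigma>\<bar> = 1"
    and "\<And>i. i \<in> S \<Longrightarrow> dir_sign (ori i) (c i) = \<sigma>"
    and "\<And>i. i < n \<Longrightarrow> i \<notin> S \<Longrightarrow> dir_sign (ori i) (c i) = - of_bool (mdl = Basic) * \<sigma>"
  shows "rot_index n ori c = 0 \<longleftrightarrow> card S = 0 \<or> card S = n"
proof -
  have card: "card S \<le> n" using card_mono[OF _ assms(1)] by simp
  have unit: "\<sigma> dvd 1" using assms(4) by (cases "\<sigma> = 1") (simp_all add: abs_if split: if_splits)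
  have "rot_index n ori c = 0 \<longleftrightarrow> int n dvd int (card S) - of_bool (mdl = Basic) * int (n - card S)"
    using rot_index_eq_0_iff[OF assms(2)] sum_dir_sign_split[OF assms(1,5,6)] unit
    by (simp add: dvd_mult_unit_iff')
  also have "\<dots> \<longleftrightarrow> card S = 0 \<or> card S = n"
  proof (cases "mdl = Basic")
    case True
    then show ?thesis
      using assms(3) card odd_int_dvd_twice_minus_iff[of n "card S"] by (simp add: of_nat_diff)
  next
    case False
    then show ?thesis using assms(2) card int_dvd_iff_extreme by simp
  qed
  finally show ?thesis .
qed

lemma rot_index_single_coprime:
  assumes "L < n" "mdl = Lazy \<or> odd n" "\<bar>\<sigma>\<bar> = 1"
    and "dir_sign (ori L) (c L) = \<sigma>"
    and "\<And>i. i < n \<Longrightarrow> i \<noteq> L \<Longrightarrow> dir_sign (ori i) (c i) = - of_bool (mdl = Basic) * \<sigma>"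
  shows "coprime (rot_index n ori c) n"
proof -
  have n: "0 < n" using assms(1) by simp
  have "(\<Sum>i<n. dir_sign (ori i) (c i)) = \<sigma> * (1 - of_bool (mdl = Basic) * int (n - 1))"
    using sum_dir_sign_split[of "{L}" n ori c \<sigma> mdl] assms by auto
  moreover have "coprime (1 - of_bool (mdl = Basic) * int (n - 1)) (int n)"
  proof (cases "mdl = Basic")
    case True
    then have "coprime 2 (int n)" using assms(2) by simp
    then have "coprime (2 - int n) (int n)"
      using gcd_diff1[of 2 "int n"] by (simp add: coprime_iff_gcd_eq_1)
    moreover have "1 - int (n - 1) = 2 - int n" using n by (simp add: of_nat_diff)
    ultimately show ?thesis using True by simp
  qed simp
  moreover have "coprime \<sigma> (int n)"
    using assms(3) by (cases "\<sigma> = 1") (simp_all add: abs_if split: if_splits)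
  ultimately have "coprime (\<Sum>i<n. dir_sign (ori i) (c i)) (int n)" by simp
  then have "coprime (int (rot_index n ori c)) (int n)" using n by (simp add: int_rot_index)
  then show ?thesis by simp
qed

lemma rot_index_all_right_eq_0:
  assumes "odd n" "rot_index n ori (\<lambda>_. Right) = 0"
  shows "\<exists>\<kappa>. \<forall>i<n. ori i = \<kappa>"
proof -
  define S where "S = {i. i < n \<and> ori i}"
  have "card S = 0 \<or> card S = n"
    using assms rot_index_split_eq_0_iff[of S n Basic 1 ori "\<lambda>_. Right"]
    by (auto simp: S_def dir_sign_def obj_cw_def obj_acw_def odd_pos)
  moreover have "finite S" "S \<subseteq> {..<n}" by (auto simp: S_def)
  ultimately have "S = {} \<or> S = {..<n}" using card_subset_eq[of "{..<n}" S] by auto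
  then show ?thesis by (auto simp: S_def)
qed

section \<open>Distances between initial positions\<close>

lemma own_dist_trans: "own_dist ori x z = frac (own_dist ori x y + own_dist ori y z)"
  unfolding own_dist_def by (auto simp: frac_add_simps)

lemma own_dist_False: "own_dist False x y = own_dist True y x"
  by (simp add: own_dist_def)

locale circle_config =
  fixes N n :: nat and p :: "nat \<Rightarrow> real" and ident :: "nat \<Rightarrow> nat"
  assumes valid: "valid_config N n p ident"
begin

lemma n_pos: "0 < n"
  using valid by (simp add: valid_config_def)

lemma p_range: "i < n \<Longrightarrow> 0 \<le> p i \<and> p i < 1"
  using valid by (simp add: valid_config_def)

lemma p_less: "i < j \<Longrightarrow> j < n \<Longrightarrow> p i < p j"
  using valid by (simp add: valid_config_def)

lemma ident_less_two_power: "i < n \<Longrightarrow> ident i < 2 ^ floorlog 2 N"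
  using valid floorlog_bounds[of N 2] by (force simp: valid_config_def)

lemma own_dist_cw:
  assumes "a < n" "b < n"
  shows "own_dist True (p a) (p b) = p b - p a + of_bool (b < a)"
proof (cases "b < a")
  case True
  then have "0 \<le> p b - p a + 1 \<and> p b - p a + 1 < 1"
    using p_range[OF assms(1)] p_range[OF assms(2)] p_less[OF True assms(1)] by linarith
  moreover have "frac (p b - p a) = frac (p b - p a + 1)" by (simp only: frac_1_eq)
  ultimately show ?thesis using True by (simp add: own_dist_def frac_eq)
next
  case False
  then have "p a \<le> p b" using p_less[OF _ assms(2), of a] by (cases "a = b") auto
  then show ?thesis
    using False p_range[OF assms(1)] p_range[OF assms(2)] by (simp add: own_dist_def frac_eq)
qed

lemma own_dist_eq_0_iff:
  assumes "a < n" "b < n"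
  shows "own_dist ori (p a) (p b) = 0 \<longleftrightarrow> a = b"
proof -
  have "own_dist True (p x) (p y) = 0 \<longleftrightarrow> x = y" if "x < n" "y < n" for x y
    using own_dist_cw[OF that] p_range[OF that(1)] p_range[OF that(2)]
      p_less[OF _ that(2), of x] p_less[OF _ that(1), of y]
    by (cases x y rule: linorder_cases) auto
  then show ?thesis using assms by (cases ori) (auto simp: own_dist_False)
qed

end

lemma cyclic_walk_wraps:
  fixes x :: "nat \<Rightarrow> nat"
  assumes "r < n" "x 0 < n" and step: "\<And>k. x (Suc k) = (x k + r) mod n" and closed: "x m = x 0"
  shows "n * (\<Sum>k<m. of_bool (x (Suc k) < x k)) = m * r"
proof -
  have x: "x k < n" for k using assms(1,2) step by (cases k) auto
  have "int (x (Suc k)) - int (x k) = int r - int n * of_bool (x (Suc k) < x k)" for k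
  proof (cases "x k + r < n")
    case True then show ?thesis using step[of k] by simp
  next
    case False
    then have "x (Suc k) = x k + r - n" using step[of k] x[of k] assms(1) by (simp add: le_mod_geq)
    then show ?thesis using False assms(1) by (simp add: of_nat_diff)
  qed
  then have "0 = (\<Sum>k<m. int r - int n * of_bool (x (Suc k) < x k))"
    using sum_lessThan_telescope[of "\<lambda>k. int (x k)" m] closed by simp
  then have "int (n * (\<Sum>k<m. of_bool (x (Suc k) < x k))) = int (m * r)"
    by (simp add: sum_subtractf sum_distrib_left)
  then show ?thesis by (simp only: of_nat_eq_iff)
qed

text \<open>\<open>a\<close> indexes the cosets of the subgroup of \<open>\<int>/n\<close> generated by \<open>r\<close>, and \<open>k * r\<close> runs
through that subgroup.\<close>

lemma coset_decomposition:
  fixes n r s j :: nat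
  assumes "0 < n" "coprime s n"
  shows "\<exists>a < gcd r n. \<exists>k < n div gcd r n. [a * s + k * r = j] (mod n)"
proof -
  define g where "g = gcd r n"
  define m where "m = n div g"
  have g: "0 < g" "g dvd n" "g dvd r" using assms(1) by (simp_all add: g_def)
  have n_eq: "n = g * m" using g by (simp add: m_def)
  have "coprime s g" using coprime_divisors[OF dvd_refl g(2) assms(2)] .
  then have "gcd (int s) (int g) dvd int j" by simp
  then obtain a' where "[int s * a' = int j] (mod int g)"
    using cong_solve_dvd_int by blast
  then have "[int s * (a' mod int g) = int j] (mod int g)"
    by (simp add: cong_def mod_mult_right_eq)
  then have "gcd (int r) (int n) dvd int j - int s * (a' mod int g)"
    by (simp add: g_def cong_iff_dvd_diff dvd_diff_commute)
  then obtain k' where k': "[int r * k' = int j - int s * (a' mod int g)] (mod int n)"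
    using cong_solve_dvd_int by blast
  have "[int r * (k' mod int m) = int r * k'] (mod int n)"
  proof -
    have "int r * k' - int r * (k' mod int m) = int r * (k' - k' mod int m)"
      by (simp add: right_diff_distrib)
    also have "\<dots> = int r * int m * (k' div int m)" by (simp add: minus_mod_eq_mult_div)
    finally have "int r * k' - int r * (k' mod int m) = int r * int m * (k' div int m)" .
    moreover have "int n dvd int r * int m" using g(3) n_eq by (auto simp: mult.commute)
    ultimately show ?thesis by (simp add: cong_iff_dvd_diff dvd_diff_commute)
  qed
  then have "[int r * (k' mod int m) = int j - int s * (a' mod int g)] (mod int n)"
    using k' by (rule cong_trans)
  then have "[int (nat (a' mod int g) * s + nat (k' mod int m) * r) = int j] (mod int n)"
    using g(1) n_eq assms(1) by (simp add: cong_iff_dvd_diff algebra_simps)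
  moreover have "nat (a' mod int g) < g" "nat (k' mod int m) < m"
    using g(1) n_eq assms(1) by (simp_all add: nat_less_iff)
  ultimately show ?thesis unfolding g_def[symmetric] m_def[symmetric] cong_int_iff by blast
qed

lemma mod_add_eq_self_iff: "x < n \<Longrightarrow> s < n \<Longrightarrow> (x + s) mod n = x \<longleftrightarrow> s = (0 :: nat)"
  by (cases "x + s < n") (auto simp: le_mod_geq)

lemma eq_if_bits_below_eq:
  fixes x y :: nat
  assumes "x < 2 ^ B" "y < 2 ^ B" "\<And>c. c < B \<Longrightarrow> bit x c = bit y c"
  shows "x = y"
proof -
  have "take_bit B x = take_bit B y"
    using assms(3) by (auto simp: bit_eq_iff bit_take_bit_iff)
  then show ?thesis
    using take_bit_nat_eq_self_iff[THEN iffD2, OF assms(1)] take_bit_nat_eq_self_iff[THEN iffD2, OF assms(2)]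
    by simp
qed

lemma floorlog_2_le_twice_log:
  assumes "2 \<le> N"
  shows "real (floorlog 2 N) \<le> 2 * log 2 (real N)"
proof -
  have "1 \<le> log 2 (real N)" using assms by simp
  moreover have "real (floorlog 2 N) \<le> log 2 (real N) + 1"
    using assms by (simp add: floorlog_def)
  ultimately show ?thesis by linarith
qed

lemma proportional_less_iff:
  fixes w m r n :: real
  assumes "0 < n" "0 < m" "n * w = m * r"
  shows "w < m \<longleftrightarrow> r < n" and "m < w \<longleftrightarrow> n < r"
proof -
  have "w < m \<longleftrightarrow> n * w < n * m" "m < w \<longleftrightarrow> n * m < n * w" using assms(1) by simp_all
  moreover have "r < n \<longleftrightarrow> m * r < m * n" "n < r \<longleftrightarrow> m * n < m * r" using assms(2) by simp_all
  ultimately show "w < m \<longleftrightarrow> r < n" and "m < w \<longleftrightarrow> n < r"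
    using assms(3) by (simp_all add: mult.commute)
qed

section \<open>The algorithm\<close>

definition returned_after :: "real list \<Rightarrow> nat \<Rightarrow> bool" where
  "returned_after h k \<longleftrightarrow> frac (sum_list (take k h)) = 0"

definition has_returned :: "real list \<Rightarrow> bool" where
  "has_returned h \<longleftrightarrow> (\<exists>k. 0 < k \<and> k \<le> length h \<and> returned_after h k)"

definition first_return :: "real list \<Rightarrow> nat" where
  "first_return h = (LEAST k. 0 < k \<and> k \<le> length h \<and> returned_after h k)"

text \<open>Observation \<open>h ! (r + 2 * b)\<close> is that of the round testing ID bit \<open>b\<close>; it is nonzero iff the
round moved the agents, i.e. iff the remaining candidates disagree on bit \<open>b\<close>.\<close>

fun still_candidate :: "real list \<Rightarrow> nat \<Rightarrow> nat \<Rightarrow> bool \<Rightarrow> nat \<Rightarrow> bool" where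
  "still_candidate h r x c 0 = c"
| "still_candidate h r x c (Suc b) = (still_candidate h r x c b \<and> (h ! (r + 2 * b) \<noteq> 0 \<longrightarrow> bit x b))"

definition agreed_cw :: "bool \<Rightarrow> dir" where
  "agreed_cw keep = (if keep then Right else Left)"

definition move_dir :: "model \<Rightarrow> bool \<Rightarrow> bool \<Rightarrow> dir" where
  "move_dir mdl keep active =
    (if active then agreed_cw keep else if mdl = Lazy then Idle else reverse_dir (agreed_cw keep))"

definition default_dir :: "model \<Rightarrow> dir \<Rightarrow> dir" where
  "default_dir mdl d = (if allowed mdl d then d else Right)"

text \<open>The agent with ID \<open>x\<close> and input \<open>a\<close> repeats the move \<open>dflt a\<close> until it first returns to its
starting point, after \<open>r\<close> rounds; then \<open>keep a (take r h) r\<close> says whether its own clockwise is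
the agreed one and \<open>cand a\<close> whether it is a leader candidate. Next come \<open>B N\<close> pairs of rounds,
each testing an ID bit and then undoing the test; afterwards every \<open>r\<close>-th round is a leader
round and all others are default moves.\<close>

definition ld_alg :: "model \<Rightarrow> (nat \<Rightarrow> nat) \<Rightarrow> ('a \<Rightarrow> dir) \<Rightarrow> ('a \<Rightarrow> real list \<Rightarrow> nat \<Rightarrow> bool)
    \<Rightarrow> ('a \<Rightarrow> bool) \<Rightarrow> nat \<Rightarrow> nat \<Rightarrow> nat \<Rightarrow> 'a \<Rightarrow> real list \<Rightarrow> dir" where
  "ld_alg mdl B dflt keep cand N n x a h =
    (if \<not> has_returned h then default_dir mdl (dflt a)
     else let r = first_return h; u = length h - r; kp = keep a (take r h) r in
       if u < 2 * B N then
         (let d = move_dir mdl kp (still_candidate h r x (cand a) (u div 2) \<and> bit x (u div 2))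
          in if even u then d else reverse_dir d)
       else if (u - 2 * B N) mod r = 0 then move_dir mdl kp (still_candidate h r x (cand a) (B N))
       else default_dir mdl (dflt a))"

definition winding_keep :: "real list \<Rightarrow> nat \<Rightarrow> bool" where
  "winding_keep h r \<longleftrightarrow> 2 * sum_list h < real r"

definition ld_output :: "real list \<Rightarrow> real set" where
  "ld_output h = {frac (sum_list (take k h)) | k. k \<le> length h} - {0}"

lemma allowed_reverse_dir: "allowed mdl d \<Longrightarrow> allowed mdl (reverse_dir d)"
  by (cases d) (auto simp: allowed_def reverse_dir_def)

lemma allowed_move_dir: "allowed mdl (move_dir mdl keep active)"
  by (auto simp: move_dir_def agreed_cw_def allowed_def reverse_dir_def)

lemma allowed_default_dir: "allowed mdl (default_dir mdl d)"
  by (simp add: default_dir_def allowed_def)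

lemma allowed_ld_alg: "allowed mdl (ld_alg mdl B dflt keep cand N n x a h)"
  by (simp add: ld_alg_def Let_def allowed_move_dir allowed_default_dir allowed_reverse_dir)

lemma dir_sign_move_dir:
  "dir_sign ori (move_dir mdl keep active) =
     (if active then 1 else - of_bool (mdl = Basic)) * (if ori = keep then 1 else -1)"
  by (cases mdl) (auto simp: move_dir_def agreed_cw_def dir_sign_def obj_cw_def obj_acw_def reverse_dir_def)

lemma rot_index_move_dir_eq_0_iff:
  assumes "\<forall>i<n. (ori i = keep i) = \<kappa>" "S \<subseteq> {..<n}" "0 < n" "mdl = Lazy \<or> odd n"
  shows "rot_index n ori (\<lambda>i. move_dir mdl (keep i) (i \<in> S)) = 0 \<longleftrightarrow> card S = 0 \<or> card S = n"
  by (rule rot_index_split_eq_0_iff[where \<sigma> = "if \<kappa> then 1 else -1"])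
    (use assms in \<open>auto simp: dir_sign_move_dir\<close>)

lemma rot_index_move_dir_single_coprime:
  assumes "L < n" "mdl = Lazy \<or> odd n" "mdl = Basic \<Longrightarrow> \<forall>i<n. (ori i = keep i) = \<kappa>"
  shows "coprime (rot_index n ori (\<lambda>i. move_dir mdl (keep i) (i = L))) n"
proof -
  define \<sigma> :: int where "\<sigma> = (if ori L = keep L then 1 else -1)"
  have others: "dir_sign (ori i) (move_dir mdl (keep i) (i = L)) = - of_bool (mdl = Basic) * \<sigma>"
    if "i < n" "i \<noteq> L" for i
  proof (cases "mdl = Basic")
    case True
    then have "(ori i = keep i) = (ori L = keep L)" using assms(1,3) that by auto
    then show ?thesis using True that by (simp add: dir_sign_move_dir \<sigma>_def)
  qed (simp add: dir_sign_move_dir that)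
  show ?thesis
    by (rule rot_index_single_coprime[OF assms(1,2) _ _ others]) (simp_all add: dir_sign_move_dir \<sigma>_def)
qed

section \<open>Executions of the algorithm\<close>

locale ld_execution = circle_config N n p ident
  for N n :: nat and p :: "nat \<Rightarrow> real" and ident :: "nat \<Rightarrow> nat" +
  fixes ori :: "nat \<Rightarrow> bool" and inp :: "nat \<Rightarrow> 'a" and mdl :: model and B :: "nat \<Rightarrow> nat"
    and dflt :: "'a \<Rightarrow> dir" and keep :: "'a \<Rightarrow> real list \<Rightarrow> nat \<Rightarrow> bool" and cand :: "'a \<Rightarrow> bool"
begin

abbreviation alg where "alg \<equiv> ld_alg mdl B dflt keep cand"

definition shift :: "nat \<Rightarrow> nat" where
  "shift t = fst (run alg N n p ori ident inp t)"

definition hist :: "nat \<Rightarrow> nat \<Rightarrow> real list" where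
  "hist t = snd (run alg N n p ori ident inp t)"

definition choice :: "nat \<Rightarrow> nat \<Rightarrow> dir" where
  "choice t i = alg N n (ident i) (inp i) (hist t i)"

definition rot :: "nat \<Rightarrow> nat" where
  "rot t = rot_index n ori (choice t)"

definition obs :: "nat \<Rightarrow> nat \<Rightarrow> real" where
  "obs t i = own_dist (ori i) (p ((i + shift t) mod n)) (p ((i + shift t + rot t) mod n))"

lemma shift_0: "shift 0 = 0" and hist_0: "hist 0 i = []"
  by (simp_all add: shift_def hist_def)

lemma shift_Suc: "shift (Suc t) = (shift t + rot t) mod n"
  and hist_Suc: "hist (Suc t) i = hist t i @ [obs t i]"
proof -
  obtain s h where "run alg N n p ori ident inp t = (s, h)" by fastforce
  moreover from this have "shift t = s" "hist t = h" by (simp_all add: shift_def hist_def)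
  moreover from this have "choice t = (\<lambda>i. alg N n (ident i) (inp i) (h i))"
    by (simp add: choice_def fun_eq_iff)
  ultimately show "shift (Suc t) = (shift t + rot t) mod n" "hist (Suc t) i = hist t i @ [obs t i]"
    by (simp_all add: shift_def hist_def rot_def obs_def Let_def)
qed

lemma shift_less: "shift t < n"
  by (cases t) (simp_all add: shift_0 n_pos shift_Suc)

lemma rot_less: "rot t < n"
  by (simp add: rot_def rot_index_less n_pos)

lemma length_hist: "length (hist t i) = t"
  by (induction t) (simp_all add: hist_0 hist_Suc)

lemma take_hist: "k \<le> t \<Longrightarrow> take k (hist t i) = hist k i"
proof (induction t)
  case (Suc t)
  then show ?case by (cases "k = Suc t") (simp_all add: hist_Suc length_hist)
qed (simp add: hist_0)

lemma nth_hist: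
  assumes "k < t"
  shows "hist t i ! k = obs k i"
proof -
  have "hist t i ! k = take (Suc k) (hist t i) ! k" by simp
  also have "\<dots> = obs k i" using assms by (simp add: take_hist hist_Suc nth_append length_hist)
  finally show ?thesis .
qed

lemma sum_list_hist: "sum_list (hist t i) = (\<Sum>k<t. obs k i)"
  by (induction t) (simp_all add: hist_0 hist_Suc)

lemma frac_sum_list_hist:
  assumes "i < n"
  shows "frac (sum_list (hist t i)) = own_dist (ori i) (p i) (p ((i + shift t) mod n))"
proof (induction t)
  case 0
  then show ?case using assms by (simp add: hist_0 shift_0 own_dist_def)
next
  case (Suc t)
  have "frac (sum_list (hist (Suc t) i)) = frac (frac (sum_list (hist t i)) + obs t i)"
    by (simp add: hist_Suc)
  also have "\<dots> = own_dist (ori i) (p i) (p ((i + shift t + rot t) mod n))"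
    unfolding Suc obs_def by (rule own_dist_trans[symmetric])
  also have "(i + shift t + rot t) mod n = (i + shift (Suc t)) mod n"
    by (simp add: shift_Suc mod_add_right_eq add.assoc)
  finally show ?case .
qed

lemma returned_after_hist_iff:
  assumes "i < n" "k \<le> t"
  shows "returned_after (hist t i) k \<longleftrightarrow> shift k = 0"
proof -
  have "returned_after (hist t i) k \<longleftrightarrow> own_dist (ori i) (p i) (p ((i + shift k) mod n)) = 0"
    unfolding returned_after_def take_hist[OF assms(2)] frac_sum_list_hist[OF assms(1)] ..
  also have "\<dots> \<longleftrightarrow> (i + shift k) mod n = i"
    using own_dist_eq_0_iff[OF assms(1), of "(i + shift k) mod n"] n_pos by auto
  finally show ?thesis using mod_add_eq_self_iff[OF assms(1) shift_less] by simp
qed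

lemma obs_eq_0_iff:
  assumes "i < n"
  shows "obs t i = 0 \<longleftrightarrow> rot t = 0"
proof -
  define x where "x = (i + shift t) mod n"
  have x: "x < n" using n_pos by (simp add: x_def)
  have "obs t i = own_dist (ori i) (p x) (p ((x + rot t) mod n))"
    by (simp add: obs_def x_def mod_add_left_eq)
  then have "obs t i = 0 \<longleftrightarrow> (x + rot t) mod n = x"
    using own_dist_eq_0_iff[OF x, of "(x + rot t) mod n"] n_pos by auto
  then show ?thesis using mod_add_eq_self_iff[OF x rot_less] by simp
qed

definition dflt_round :: "nat \<Rightarrow> dir" where
  "dflt_round i = default_dir mdl (dflt (inp i))"

definition r0 :: nat where
  "r0 = rot_index n ori dflt_round"

definition period :: nat where
  "period = n div gcd r0 n"

definition agreed :: "nat \<Rightarrow> bool" where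
  "agreed i = keep (inp i) (hist period i) period"

definition test_round :: "nat set \<Rightarrow> nat \<Rightarrow> nat \<Rightarrow> dir" where
  "test_round S b i = move_dir mdl (agreed i) (i \<in> S \<and> bit (ident i) b)"

fun cands :: "nat \<Rightarrow> nat set" where
  "cands 0 = {i. i < n \<and> cand (inp i)}"
| "cands (Suc b) =
    (if rot_index n ori (test_round (cands b) b) = 0 then cands b else {i \<in> cands b. bit (ident i) b})"

definition leader_round :: "nat \<Rightarrow> dir" where
  "leader_round i = move_dir mdl (agreed i) (i \<in> cands (B N))"

definition leader_rot :: nat where
  "leader_rot = rot_index n ori leader_round"

definition schedule :: "nat \<Rightarrow> nat \<Rightarrow> dir" where
  "schedule t =
    (if t < period then dflt_round
     else if t - period < 2 * B N then
       (if even (t - period) then test_round (cands ((t - period) div 2)) ((t - period) div 2)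
        else (\<lambda>i. reverse_dir (test_round (cands ((t - period) div 2)) ((t - period) div 2) i)))
     else if (t - period - 2 * B N) mod period = 0 then leader_round else dflt_round)"

lemma r0_less: "r0 < n"
  by (simp add: r0_def rot_index_less n_pos)

lemma period_pos: "0 < period"
  using n_pos by (simp add: period_def div_greater_zero_iff)

lemma period_le: "period \<le> n"
  by (simp add: period_def)

lemma n_eq_gcd_mult_period: "n = gcd r0 n * period"
  by (simp add: period_def)

lemma dvd_mult_r0_iff: "n dvd k * r0 \<longleftrightarrow> period dvd k"
proof -
  define g where "g = gcd r0 n"
  have g: "0 < g" using n_pos by (simp add: g_def)
  have "coprime period (r0 div g)"
    unfolding period_def g_def using div_gcd_coprime[of n r0] n_pos by (simp add: gcd.commute)
  moreover have "n dvd k * r0 \<longleftrightarrow> g * period dvd g * (k * (r0 div g))"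
    using n_eq_gcd_mult_period by (simp add: g_def ac_simps)
  ultimately show ?thesis using g by (simp add: coprime_dvd_mult_left_iff)
qed

lemma cong_mult_r0:
  assumes "[x = y] (mod period)"
  shows "[x * r0 = y * r0] (mod n)"
proof -
  obtain c where c: "int x - int y = int period * c"
    using assms by (auto simp: cong_int_iff[symmetric] cong_iff_dvd_diff)
  obtain d where d: "period * r0 = n * d" using dvd_mult_r0_iff[of period] by auto
  have "int x * int r0 - int y * int r0 = (int x - int y) * int r0" by (simp add: left_diff_distrib)
  also have "\<dots> = int n * (c * int d)" using c arg_cong[OF d, of int] by (simp add: ac_simps)
  finally show ?thesis by (simp add: cong_int_iff[symmetric] cong_iff_dvd_diff)
qed

text \<open>The induction hypothesis of \<open>choice_eq_schedule\<close>: the rounds before \<open>t\<close> follow the schedule.\<close>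

context
  fixes t :: nat
  assumes rot_before: "\<And>k. k < t \<Longrightarrow> rot k = rot_index n ori (schedule k)"
begin

lemma shift_default_phase_before: "k \<le> t \<Longrightarrow> k \<le> period \<Longrightarrow> shift k = (k * r0) mod n"
proof (induction k)
  case (Suc k)
  then have "rot k = r0" using rot_before by (simp add: schedule_def r0_def)
  then show ?case using Suc by (simp add: shift_Suc mod_add_right_eq add.commute)
qed (simp add: shift_0)

lemma returned_after_hist_iff_period:
  assumes "i < n" "0 < k" "k \<le> t" "k \<le> period"
  shows "returned_after (hist t i) k \<longleftrightarrow> k = period"
proof -
  have "returned_after (hist t i) k \<longleftrightarrow> (k * r0) mod n = 0"
    using assms returned_after_hist_iff shift_default_phase_before by simp
  also have "\<dots> \<longleftrightarrow> period dvd k" by (simp add: dvd_mult_r0_iff flip: dvd_eq_mod_eq_0)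
  finally show ?thesis using assms(2,4) by (auto dest: dvd_imp_le)
qed

lemma has_returned_hist_iff:
  assumes "i < n"
  shows "has_returned (hist t i) \<longleftrightarrow> period \<le> t"
proof
  assume "has_returned (hist t i)"
  then obtain k where "0 < k" "k \<le> t" "returned_after (hist t i) k"
    by (auto simp: has_returned_def length_hist)
  then show "period \<le> t"
    using returned_after_hist_iff_period[OF assms] by (cases "k \<le> period") auto
next
  assume "period \<le> t"
  then show "has_returned (hist t i)"
    using returned_after_hist_iff_period[OF assms] period_pos
    unfolding has_returned_def length_hist by blast
qed

lemma first_return_hist:
  assumes "i < n" "period \<le> t"
  shows "first_return (hist t i) = period"
  unfolding first_return_def length_hist
proof (rule Least_equality)
  show "0 < period \<and> period \<le> t \<and> returned_after (hist t i) period"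
    using assms period_pos returned_after_hist_iff_period by simp
next
  show "period \<le> k" if "0 < k \<and> k \<le> t \<and> returned_after (hist t i) k" for k
    using that assms returned_after_hist_iff_period[of i k] by (cases "k \<le> period") auto
qed

lemma still_candidate_hist_iff:
  assumes "i < n"
  shows "b \<le> B N \<Longrightarrow> period + 2 * b \<le> t \<Longrightarrow>
    still_candidate (hist t i) period (ident i) (cand (inp i)) b \<longleftrightarrow> i \<in> cands b"
proof (induction b)
  case (Suc b)
  have "hist t i ! (period + 2 * b) \<noteq> 0 \<longleftrightarrow> rot_index n ori (test_round (cands b) b) \<noteq> 0"
    using Suc.prems nth_hist obs_eq_0_iff[OF assms] rot_before by (simp add: schedule_def)
  then show ?case using Suc by auto
qed (use assms in simp)

lemma choice_eq_schedule_step: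
  assumes i: "i < n"
  shows "choice t i = schedule t i"
proof (cases "t < period")
  case True
  then show ?thesis
    using has_returned_hist_iff[OF i] by (simp add: choice_def ld_alg_def schedule_def dflt_round_def)
next
  case False
  define u where "u = t - period"
  have returned: "has_returned (hist t i)" "first_return (hist t i) = period"
    using False has_returned_hist_iff[OF i] first_return_hist[OF i] by simp_all
  have agreed: "keep (inp i) (take period (hist t i)) period = agreed i"
    using False by (simp add: take_hist agreed_def)
  show ?thesis
  proof (cases "u < 2 * B N")
    case True
    then have "still_candidate (hist t i) period (ident i) (cand (inp i)) (u div 2) \<longleftrightarrow> i \<in> cands (u div 2)"
      using False by (intro still_candidate_hist_iff[OF i]) (simp_all add: u_def)
    then show ?thesis using True False returned agreed
      by (simp add: choice_def ld_alg_def schedule_def Let_def test_round_def length_hist u_def)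
  next
    case u: False
    then have "still_candidate (hist t i) period (ident i) (cand (inp i)) (B N) \<longleftrightarrow> i \<in> cands (B N)"
      using False by (intro still_candidate_hist_iff[OF i]) (simp_all add: u_def)
    then show ?thesis using u False returned agreed
      by (simp add: choice_def ld_alg_def schedule_def Let_def leader_round_def dflt_round_def length_hist u_def)
  qed
qed

end

lemma choice_eq_schedule: "i < n \<Longrightarrow> choice t i = schedule t i"
proof (induction t arbitrary: i rule: less_induct)
  case (less t)
  have "rot k = rot_index n ori (schedule k)" if "k < t" for k
    unfolding rot_def using less that by (intro rot_index_cong) simp
  then show ?case using choice_eq_schedule_step less.prems by blast
qed

lemma rot_eq_schedule: "rot t = rot_index n ori (schedule t)"
  unfolding rot_def by (rule rot_index_cong) (simp add: choice_eq_schedule)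

lemma rot_default_phase: "k < period \<Longrightarrow> rot k = r0"
  by (simp add: rot_eq_schedule schedule_def r0_def)

lemma shift_default_phase: "k \<le> period \<Longrightarrow> shift k = (k * r0) mod n"
  by (rule shift_default_phase_before[of k]) (simp_all add: rot_eq_schedule)

subsection \<open>Direction agreement by winding numbers\<close>

lemma sum_list_hist_period:
  assumes "r0 \<noteq> 0" "i < n"
  shows "\<exists>W. real n * W = real period * real r0 \<and> sum_list (hist period i) = (if ori i then W else real period - W)"
proof -
  define x where "x k = (i + k * r0) mod n" for k
  define wraps where "wraps = (\<Sum>k<period. of_bool (x (Suc k) < x k) :: nat)"
  have x: "x k < n" for k using n_pos by (simp add: x_def)
  have x_Suc: "x (Suc k) = (x k + r0) mod n" for k by (simp add: x_def mod_add_right_eq add_ac)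
  have x_neq: "x (Suc k) \<noteq> x k" for k
    using mod_add_eq_self_iff[OF x r0_less] assms(1) by (simp add: x_Suc)
  have closed: "x period = x 0"
  proof -
    obtain d where "period * r0 = n * d" using dvd_mult_r0_iff[of period] by auto
    then show ?thesis by (simp add: x_def)
  qed
  have "n * wraps = period * r0"
    unfolding wraps_def by (rule cyclic_walk_wraps[OF r0_less x x_Suc closed])
  then have wraps: "real n * real wraps = real period * real r0"
    using arg_cong[of _ _ real] by fastforce
  have obs: "obs k i = own_dist (ori i) (p (x k)) (p (x (Suc k)))" if "k < period" for k
  proof -
    have pos: "(i + shift k) mod n = x k"
      using that shift_default_phase[of k] by (simp add: x_def mod_add_right_eq)
    have "(i + shift k + rot k) mod n = ((i + shift k) mod n + rot k) mod n"
      by (simp add: mod_add_left_eq)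
    also have "\<dots> = x (Suc k)" using pos that rot_default_phase[of k] by (simp add: x_Suc)
    finally show ?thesis using pos by (simp add: obs_def)
  qed
  have cw: "own_dist True (p (x k)) (p (x (Suc k))) = p (x (Suc k)) - p (x k) + of_bool (x (Suc k) < x k)"
    for k by (rule own_dist_cw[OF x x])
  have acw: "own_dist False (p (x k)) (p (x (Suc k))) = 1 - own_dist True (p (x k)) (p (x (Suc k)))" for k
    using own_dist_cw[OF x x, of "Suc k" k] cw[of k] x_neq[of k]
    by (cases "x (Suc k) < x k") (simp_all add: own_dist_False)
  have "(\<Sum>k<period. own_dist True (p (x k)) (p (x (Suc k))))
      = (\<Sum>k<period. p (x (Suc k)) - p (x k)) + (\<Sum>k<period. of_bool (x (Suc k) < x k))"
    by (simp add: cw sum.distrib)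
  also have "\<dots> = real wraps"
    using sum_lessThan_telescope[of "\<lambda>k. p (x k)" period] closed by (simp add: wraps_def)
  finally have sum_cw: "(\<Sum>k<period. own_dist True (p (x k)) (p (x (Suc k)))) = real wraps" .
  have "sum_list (hist period i) = (\<Sum>k<period. own_dist (ori i) (p (x k)) (p (x (Suc k))))"
    by (simp add: sum_list_hist obs)
  also have "\<dots> = (if ori i then real wraps else real period - real wraps)"
    using sum_cw by (simp add: acw sum_subtractf)
  finally show ?thesis using wraps by (intro exI[of _ "real wraps"] conjI)
qed

lemma agreed_by_winding:
  assumes "\<And>a h r. keep a h r = winding_keep h r" "r0 \<noteq> 0" "2 * r0 \<noteq> n"
  shows "\<forall>i<n. (ori i = agreed i) = (2 * r0 < n)"
proof (intro allI impI)
  fix i assume "i < n"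
  obtain W where W: "real n * W = real period * real r0"
    and sum: "sum_list (hist period i) = (if ori i then W else real period - W)"
    using sum_list_hist_period[OF assms(2) \<open>i < n\<close>] by blast
  have "0 < real n" "0 < real period" using n_pos period_pos by simp_all
  moreover have "real n * (2 * W) = real period * (2 * real r0)" using W by simp
  ultimately have less: "2 * W < real period \<longleftrightarrow> 2 * r0 < n" "real period < 2 * W \<longleftrightarrow> n < 2 * r0"
    using proportional_less_iff[of "real n" "real period" "2 * W" "2 * real r0"]
    by (simp_all only: of_nat_less_iff[where 'a = real, symmetric] of_nat_mult of_nat_numeral)
  have agreed: "agreed i \<longleftrightarrow> 2 * sum_list (hist period i) < real period"
    by (simp add: agreed_def assms(1) winding_keep_def)
  show "(ori i = agreed i) = (2 * r0 < n)"
  proof (cases "ori i")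
    case True
    then show ?thesis using agreed sum less(1) by simp
  next
    case False
    have "2 * (real period - W) < real period \<longleftrightarrow> real period < 2 * W" by (simp add: algebra_simps)
    then have "agreed i \<longleftrightarrow> n < 2 * r0" using agreed sum less(2) False by presburger
    then show ?thesis using False assms(3) by linarith
  qed
qed

lemma agreed_if_r0_eq_0:
  assumes "\<And>a h r. keep a h r = winding_keep h r" "r0 = 0" "i < n"
  shows "agreed i"
proof -
  have "period = 1" using assms(2) n_pos by (simp add: period_def)
  moreover have "obs 0 i = 0"
    using obs_eq_0_iff[OF assms(3)] rot_default_phase[of 0] period_pos assms(2) by simp
  ultimately show ?thesis by (simp add: agreed_def assms(1) winding_keep_def sum_list_hist)
qed

subsection \<open>Leader election\<close>

lemma cands_subset: "cands b \<subseteq> {..<n}"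
  by (induction b) auto

lemma test_round_eq_0_iff:
  assumes "\<forall>i<n. (ori i = agreed i) = \<kappa>" "mdl = Lazy \<or> odd n"
  shows "rot_index n ori (test_round (cands b) b) = 0 \<longleftrightarrow>
    {i \<in> cands b. bit (ident i) b} = {} \<or> {i \<in> cands b. bit (ident i) b} = {..<n}"
proof -
  define S where "S = {i \<in> cands b. bit (ident i) b}"
  have S: "S \<subseteq> {..<n}" using cands_subset by (auto simp: S_def)
  have "test_round (cands b) b = (\<lambda>i. move_dir mdl (agreed i) (i \<in> S))"
    by (simp add: fun_eq_iff test_round_def S_def)
  then have "rot_index n ori (test_round (cands b) b) = 0 \<longleftrightarrow> card S = 0 \<or> card S = n"
    using rot_index_move_dir_eq_0_iff[OF assms(1) S n_pos assms(2)] by simp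
  also have "\<dots> \<longleftrightarrow> S = {} \<or> S = {..<n}"
    using S finite_subset[OF S] card_subset_eq[OF _ S] by auto
  finally show ?thesis by (simp only: S_def)
qed

lemma cands_agree_on_low_bits:
  assumes "\<forall>i<n. (ori i = agreed i) = \<kappa>" "mdl = Lazy \<or> odd n" "cands 0 \<noteq> {}"
  shows "cands b \<noteq> {} \<and> (\<forall>i\<in>cands b. \<forall>j\<in>cands b. \<forall>c<b. bit (ident i) c = bit (ident j) c)"
proof (induction b)
  case (Suc b)
  define S where "S = {i \<in> cands b. bit (ident i) b}"
  have test: "rot_index n ori (test_round (cands b) b) = 0 \<longleftrightarrow> S = {} \<or> S = {..<n}"
    unfolding S_def by (rule test_round_eq_0_iff[OF assms(1,2)])
  have step: "cands (Suc b) \<noteq> {} \<and> cands (Suc b) \<subseteq> cands b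
      \<and> (\<forall>i\<in>cands (Suc b). \<forall>j\<in>cands (Suc b). bit (ident i) b = bit (ident j) b)"
  proof (cases "S = {} \<or> S = {..<n}")
    case True
    have "bit (ident i) b = bit (ident j) b" if "i \<in> cands b" "j \<in> cands b" for i j
      using True
    proof
      assume "S = {}"
      then show ?thesis using that by (auto simp: S_def)
    next
      assume "S = {..<n}"
      then have "i \<in> S" "j \<in> S" using that cands_subset by auto
      then show ?thesis by (simp add: S_def)
    qed
    then show ?thesis using True test Suc.IH by (simp only: cands.simps if_True) blast
  next
    case False
    then have "cands (Suc b) = S" using test by (simp only: cands.simps S_def if_False)
    then show ?thesis using False by (auto simp: S_def)
  qed
  show ?case
  proof (intro conjI ballI allI impI)
    show "cands (Suc b) \<noteq> {}" using step by blast
  next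
    fix i j c assume ij: "i \<in> cands (Suc b)" "j \<in> cands (Suc b)" and "c < Suc b"
    then consider "c = b" | "c < b" by linarith
    then show "bit (ident i) c = bit (ident j) c"
    proof cases
      case 1
      then show ?thesis using step ij by blast
    next
      case 2
      then show ?thesis using Suc.IH step ij by blast
    qed
  qed
qed (use assms(3) in simp)

lemma card_cands_eq_1:
  assumes "\<forall>i<n. (ori i = agreed i) = \<kappa>" "mdl = Lazy \<or> odd n" "cands 0 \<noteq> {}"
    and "\<And>i. i < n \<Longrightarrow> ident i < 2 ^ B N"
  shows "card (cands (B N)) = 1"
proof -
  obtain L where L: "L \<in> cands (B N)" using cands_agree_on_low_bits[OF assms(1-3)] by blast
  have "j = L" if "j \<in> cands (B N)" for j
  proof -
    have "j < n" "L < n" using that L cands_subset by auto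
    moreover have "ident j = ident L"
    proof (rule eq_if_bits_below_eq)
      show "ident j < 2 ^ B N" "ident L < 2 ^ B N" using \<open>j < n\<close> \<open>L < n\<close> assms(4) by simp_all
      show "bit (ident j) c = bit (ident L) c" if "c < B N" for c
        using that \<open>j \<in> cands (B N)\<close> L cands_agree_on_low_bits[OF assms(1-3)] by blast
    qed
    ultimately show "j = L" using valid inj_onD[of ident "{..<n}" j L] by (simp add: valid_config_def)
  qed
  then have "cands (B N) = {L}" using L by blast
  then show ?thesis by simp
qed

lemma coprime_leader_rot:
  assumes "card (cands (B N)) = 1" "mdl = Lazy \<or> odd n" "mdl = Basic \<Longrightarrow> \<forall>i<n. (ori i = agreed i) = \<kappa>"
  shows "coprime leader_rot n"
proof -
  obtain L where L: "cands (B N) = {L}" using assms(1) card_1_singletonE by blast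
  then have "L < n" using cands_subset by auto
  moreover have "leader_round = (\<lambda>i. move_dir mdl (agreed i) (i = L))"
    by (simp add: fun_eq_iff leader_round_def L)
  ultimately show ?thesis
    unfolding leader_rot_def using rot_index_move_dir_single_coprime[OF _ assms(2,3)] by simp
qed

subsection \<open>Covering all positions\<close>

lemma shift_test_phase: "b \<le> B N \<Longrightarrow> shift (period + 2 * b) = 0"
proof (induction b)
  case 0
  show ?case using shift_default_phase[of period] dvd_mult_r0_iff[of period] by simp
next
  case (Suc b)
  have "shift (period + 2 * Suc b) = (rot (period + 2 * b) + rot (Suc (period + 2 * b))) mod n"
    using Suc rot_less by (simp add: shift_Suc mod_add_left_eq)
  also have "\<dots> = 0"
    using Suc.prems n_pos rot_index_reverse_dir[of n ori "test_round (cands b) b"]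
    by (simp add: rot_eq_schedule schedule_def)
  finally show ?case .
qed

lemma rot_leader_phase:
  "rot (period + 2 * B N + q) = (if q mod period = 0 then leader_rot else r0)"
  by (simp add: rot_eq_schedule schedule_def leader_rot_def r0_def)

lemma shift_leader_block:
  assumes start: "shift (period + 2 * B N + a * period) = (a * leader_rot + a * (period - 1) * r0) mod n"
  shows "b < period \<Longrightarrow>
    shift (period + 2 * B N + a * period + 1 + b) = ((a + 1) * leader_rot + (a * (period - 1) + b) * r0) mod n"
proof (induction b)
  case 0
  have "shift (period + 2 * B N + a * period + 1 + 0) = (shift (period + 2 * B N + a * period) + leader_rot) mod n"
    using rot_leader_phase[of "a * period"] by (simp add: shift_Suc)
  also have "\<dots> = (a * leader_rot + a * (period - 1) * r0 + leader_rot) mod n"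
    by (simp add: start mod_add_left_eq)
  also have "\<dots> = ((a + 1) * leader_rot + (a * (period - 1) + 0) * r0) mod n"
    by (simp add: algebra_simps)
  finally show ?case .
next
  case (Suc b)
  have "(a * period + 1 + b) mod period \<noteq> 0" using Suc.prems by (simp add: add.assoc)
  then have "shift (period + 2 * B N + a * period + 1 + Suc b)
      = (shift (period + 2 * B N + a * period + 1 + b) + r0) mod n"
    using rot_leader_phase[of "a * period + 1 + b"] by (simp add: shift_Suc add.assoc)
  also have "\<dots> = ((a + 1) * leader_rot + (a * (period - 1) + b) * r0 + r0) mod n"
    using Suc by (simp add: mod_add_left_eq)
  also have "\<dots> = ((a + 1) * leader_rot + (a * (period - 1) + Suc b) * r0) mod n"
    by (simp add: algebra_simps)
  finally show ?case .
qed

lemma shift_leader_phase_start: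
  "shift (period + 2 * B N + a * period) = (a * leader_rot + a * (period - 1) * r0) mod n"
proof (induction a)
  case 0
  show ?case using shift_test_phase[of "B N"] by simp
next
  case (Suc a)
  have "Suc a * period = a * period + 1 + (period - 1)" using period_pos by simp
  then show ?case
    using shift_leader_block[OF Suc, of "period - 1"] period_pos by (simp add: algebra_simps)
qed

lemma shift_covers:
  assumes "coprime leader_rot n" "j < n"
  shows "\<exists>t \<le> n + 2 * B N. shift t = j"
proof -
  obtain a k where a: "a < gcd r0 n" and k: "k < period" and j: "[a * leader_rot + k * r0 = j] (mod n)"
    using coset_decomposition[OF n_pos assms(1), of r0 j] by (auto simp: period_def)
  show ?thesis
  proof (cases a)
    case 0
    then have "shift k = j" using shift_default_phase[of k] k j assms(2) by (simp add: cong_def)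
    then show ?thesis using k period_le by (intro exI[of _ k]) auto
  next
    case (Suc a')
    define b where "b = (k + a') mod period"
    define t where "t = period + 2 * B N + a' * period + 1 + b"
    have b: "b < period" using period_pos by (simp add: b_def)
    have "a' * (period - 1) + (k + a') = k + a' * period" using period_pos by (cases period) simp_all
    then have "(a' * (period - 1) + b) mod period = (k + a' * period) mod period"
      by (simp only: b_def mod_add_right_eq)
    then have "[a' * (period - 1) + b = k] (mod period)" by (simp add: cong_def)
    then have "[(a' * (period - 1) + b) * r0 = k * r0] (mod n)" by (rule cong_mult_r0)
    then have "[(a' + 1) * leader_rot + (a' * (period - 1) + b) * r0 = a * leader_rot + k * r0] (mod n)"
      using Suc by (simp add: cong_add)
    then have "[shift t = a * leader_rot + k * r0] (mod n)"
      using shift_leader_block[OF shift_leader_phase_start b] by (simp add: t_def cong_def)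
    then have "shift t = j" using j shift_less assms(2) by (simp add: cong_def)
    moreover have "t \<le> n + 2 * B N"
    proof -
      have "t \<le> 2 * B N + (a' + 2) * period" using b by (simp add: t_def)
      also have "\<dots> \<le> 2 * B N + gcd r0 n * period" using a Suc by (intro add_left_mono mult_right_mono) simp_all
      finally show ?thesis using n_eq_gcd_mult_period by simp
    qed
    ultimately show ?thesis by blast
  qed
qed

lemma ld_output_hist:
  assumes "i < n"
  shows "ld_output (hist t i) = (\<lambda>k. own_dist (ori i) (p i) (p ((i + shift k) mod n))) ` {..t} - {0}"
proof -
  have "{frac (sum_list (take k (hist t i))) | k. k \<le> t} = (\<lambda>k. frac (sum_list (take k (hist t i)))) ` {..t}"
    by auto
  also have "\<dots> = (\<lambda>k. own_dist (ori i) (p i) (p ((i + shift k) mod n))) ` {..t}"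
    using frac_sum_list_hist[OF assms] by (intro image_cong) (simp_all add: take_hist)
  finally show ?thesis by (simp add: ld_output_def length_hist)
qed

lemma positions_visited:
  assumes "coprime leader_rot n" "i < n"
  shows "(\<lambda>k. (i + shift k) mod n) ` {..n + 2 * B N} = {..<n}"
proof
  show "{..<n} \<subseteq> (\<lambda>k. (i + shift k) mod n) ` {..n + 2 * B N}"
  proof
    fix j assume "j \<in> {..<n}"
    obtain t where t: "t \<le> n + 2 * B N" "shift t = (j + n - i) mod n"
      using shift_covers[OF assms(1), of "(j + n - i) mod n"] n_pos by auto
    have "(i + shift t) mod n = (i + (j + n - i)) mod n" by (simp add: t(2) mod_add_right_eq)
    also have "\<dots> = j" using assms(2) \<open>j \<in> {..<n}\<close> by simp
    finally show "j \<in> (\<lambda>k. (i + shift k) mod n) ` {..n + 2 * B N}" using t(1) by (metis atMost_iff image_eqI)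
  qed
qed (use n_pos in auto)

theorem ld_output_correct:
  assumes "coprime leader_rot n" "i < n"
  shows "ld_output (hist (n + 2 * B N) i) = {own_dist (ori i) (p i) (p j) | j. j < n \<and> j \<noteq> i}"
proof -
  have "ld_output (hist (n + 2 * B N) i) = (\<lambda>j. own_dist (ori i) (p i) (p j)) ` {..<n} - {0}"
    unfolding ld_output_hist[OF assms(2)] positions_visited[OF assms, symmetric] by (simp add: image_image)
  also have "\<dots> = {own_dist (ori i) (p i) (p j) | j. j < n \<and> j \<noteq> i}"
    using own_dist_eq_0_iff[OF assms(2)] by auto
  finally show ?thesis .
qed

end

lemma LD_solvable_by_ld_alg:
  assumes rounds: "\<And>N. 2 \<le> N \<Longrightarrow> real (B N) \<le> 2 * log 2 (real N)"
    and correct: "\<And>N n p ori ident inp i. valid_config N n p ident \<Longrightarrow> mdl = Lazy \<or> odd n \<Longrightarrow>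
      spec mdl n ori inp \<Longrightarrow> i < n \<Longrightarrow>
      ld_output (snd (run (ld_alg mdl B dflt keep cand) N n p ori ident inp (n + 2 * B N)) i)
        = {own_dist (ori i) (p i) (p j) | j. j < n \<and> j \<noteq> i}"
  shows "LD_solvable mdl spec"
  unfolding LD_solvable_def
proof (intro exI[of _ "4 :: real"] exI[of _ "ld_alg mdl B dflt keep cand"] exI[of _ "\<lambda>_ _ _ _. ld_output"]
    exI[of _ "\<lambda>N n. n + 2 * B N"] conjI allI impI)
  show "allowed mdl (ld_alg mdl B dflt keep cand N n x a h)" for N n x a h
    by (rule allowed_ld_alg)
  show "real (n + 2 * B N) \<le> real n + 4 * log 2 (real N)" if "4 < n \<and> n \<le> N" for N n
    using rounds[of N] that by simp
qed (use correct in blast)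

lemma LD_solvable_ntm: "LD_solvable mdl ntm_spec"
proof (rule LD_solvable_by_ld_alg[where B = "floorlog 2" and dflt = "\<lambda>d. d"
      and keep = "\<lambda>_. winding_keep" and cand = "\<lambda>_. True"])
  fix N n p ori ident and inp :: "nat \<Rightarrow> dir" and i
  assume valid: "valid_config N n p ident" and model: "mdl = Lazy \<or> odd n"
    and spec: "ntm_spec mdl n ori inp" and i: "i < n"
  interpret E: ld_execution N n p ident ori inp mdl "floorlog 2" "\<lambda>d. d" "\<lambda>_. winding_keep" "\<lambda>_. True"
    by unfold_locales (rule valid)
  have "E.r0 = rot_index n ori inp"
    unfolding E.r0_def using spec by (intro rot_index_cong) (simp add: E.dflt_round_def default_dir_def ntm_spec_def)
  then have agreed: "\<forall>i<n. (ori i = E.agreed i) = (2 * E.r0 < n)"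
    using spec by (intro E.agreed_by_winding) (simp_all add: ntm_spec_def)
  have "card (E.cands (floorlog 2 N)) = 1"
    using E.card_cands_eq_1[OF agreed model] E.ident_less_two_power E.n_pos by auto
  then have "coprime E.leader_rot n" using E.coprime_leader_rot[OF _ model] agreed by blast
  then show "ld_output (snd (run E.alg N n p ori ident inp (n + 2 * floorlog 2 N)) i)
      = {own_dist (ori i) (p i) (p j) | j. j < n \<and> j \<noteq> i}"
    using E.ld_output_correct i by (simp add: E.hist_def)
qed (rule floorlog_2_le_twice_log)

lemma LD_solvable_le: "LD_solvable mdl le_spec"
proof (rule LD_solvable_by_ld_alg[where B = "\<lambda>_. 0" and dflt = "\<lambda>_. Idle"
      and keep = "\<lambda>_. winding_keep" and cand = "\<lambda>c. c"])
  fix N n p ori ident and inp :: "nat \<Rightarrow> bool" and i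
  assume valid: "valid_config N n p ident" and model: "mdl = Lazy \<or> odd n"
    and spec: "le_spec mdl n ori inp" and i: "i < n"
  interpret E: ld_execution N n p ident ori inp mdl "\<lambda>_. 0" "\<lambda>_. Idle" "\<lambda>_. winding_keep" "\<lambda>c. c"
    by unfold_locales (rule valid)
  have agreed: "\<exists>\<kappa>. \<forall>i<n. (ori i = E.agreed i) = \<kappa>" if "mdl = Basic"
  proof -
    have odd: "odd n" using model that by auto
    show ?thesis
    proof (cases "E.r0 = 0")
      case True
      have "E.dflt_round i = Right" for i
        unfolding E.dflt_round_def default_dir_def allowed_def using that by simp
      then have "rot_index n ori (\<lambda>_. Right) = 0"
        using True unfolding E.r0_def by (metis rot_index_cong)
      then obtain \<kappa> where "\<forall>i<n. ori i = \<kappa>" using rot_index_all_right_eq_0[OF odd] by blast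
      then show ?thesis using E.agreed_if_r0_eq_0[OF _ True] by auto
    next
      case False
      have "2 * E.r0 \<noteq> n" using odd by (metis dvd_triv_left)
      then show ?thesis using E.agreed_by_winding[OF _ False] by blast
    qed
  qed
  have "card (E.cands 0) = 1" using spec by (simp add: le_spec_def)
  then have "coprime E.leader_rot n" using E.coprime_leader_rot[OF _ model] agreed by auto
  then show "ld_output (snd (run E.alg N n p ori ident inp (n + 2 * 0)) i)
      = {own_dist (ori i) (p i) (p j) | j. j < n \<and> j \<noteq> i}"
    using E.ld_output_correct i by (simp add: E.hist_def)
qed simp

lemma LD_solvable_da: "LD_solvable mdl da_spec"
proof (rule LD_solvable_by_ld_alg[where B = "floorlog 2" and dflt = "\<lambda>_. Idle"
      and keep = "\<lambda>a _ _. a" and cand = "\<lambda>_. True"])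
  fix N n p ori ident and inp :: "nat \<Rightarrow> bool" and i
  assume valid: "valid_config N n p ident" and model: "mdl = Lazy \<or> odd n"
    and spec: "da_spec mdl n ori inp" and i: "i < n"
  interpret E: ld_execution N n p ident ori inp mdl "floorlog 2" "\<lambda>_. Idle" "\<lambda>a _ _. a" "\<lambda>_. True"
    by unfold_locales (rule valid)
  obtain \<kappa> where agreed: "\<forall>i<n. (ori i = E.agreed i) = \<kappa>"
    using spec by (auto simp: da_spec_def E.agreed_def)
  have "card (E.cands (floorlog 2 N)) = 1"
    using E.card_cands_eq_1[OF agreed model] E.ident_less_two_power E.n_pos by auto
  then have "coprime E.leader_rot n" using E.coprime_leader_rot[OF _ model] agreed by blast
  then show "ld_output (snd (run E.alg N n p ori ident inp (n + 2 * floorlog 2 N)) i)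
      = {own_dist (ori i) (p i) (p j) | j. j < n \<and> j \<noteq> i}"
    using E.ld_output_correct i by (simp add: E.hist_def)
qed (rule floorlog_2_le_twice_log)

theorem lemma12:
  shows "LD_solvable Lazy ntm_spec \<and> LD_solvable Lazy le_spec \<and> LD_solvable Lazy da_spec
       \<and> LD_solvable Basic ntm_spec \<and> LD_solvable Basic le_spec \<and> LD_solvable Basic da_spec"
  using LD_solvable_ntm LD_solvable_le LD_solvable_da by blast

end
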